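(* Let $M,N\ge 2$ and let $\mathbf A=(a_{j,k})_{j,k=0}^{M-1,N-1}\in\mathbb C^{M\times N}$ with $\mathbf A\ne\mathbf 0$ and $|a_{0,0}|\ge|a_{M-1,N-1}|$. The optimal rank-1 Hankel approximation error satisfies $$\min_{c,z\in\mathbb C}\|\mathbf A-c\,\mathbf z_M(z)\mathbf z_N(z)^T\|_F^2=\|\mathbf A-\tilde c\,\tilde{\mathbf z}_M\tilde{\mathbf z}_N^T\|_F^2=\|\mathbf A\|_F^2-\sigma_0^2=\|\mathbf A\|_F^2-\|\mathbf A\|_2^2$$ if and only if the two singular vectors $\mathbf u_0,\mathbf v_0$ of $\mathbf A$ corresponding to the largest singular value $\sigma_0$ are of the form $\mathbf u_0=\tilde{\mathbf z}_M$ and $\mathbf v_0=\overline{\tilde{\mathbf z}}_N$, where $\tilde{\mathbf z}_M:=\mathbf z_M(\tilde z)$, $\tilde{\mathbf z}_N:=\mathbf z_N(\tilde z)$, and where $\tilde z$ and $\tilde c$ are given by $$\tilde z\in\mathop{\mathrm{argmax}}_{z\in\mathbb C}\bigl|\mathbf z_M(z)^*\,\mathbf A\,\overline{\mathbf z_N(z)}\bigr|,\qquad \tilde c:=\tilde{\mathbf z}_M^*\,\mathbf A\,\overline{\tilde{\mathbf z}}_N.$$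
   Context: For $z\in\mathbb C$ and $n\in\mathbb N$, $\mathbf z_n(z):=\bigl(\sum_{k=0}^{n-1}|z|^{2k}\bigr)^{-1/2}(1,z,z^2,\dots,z^{n-1})^T\in\mathbb C^n$. $\overline{\,\cdot\,}$ is entrywise complex conjugation, $\mathbf x^*=\overline{\mathbf x}^T$, $\mathbf A^*=\overline{\mathbf A}^T$; $\|\cdot\|_F$ is the Frobenius norm, and $\|\cdot\|_2$ is the spectral norm for matrices and the Euclidean norm for vectors. $\sigma_0=\|\mathbf A\|_2$ is the largest singular value of $\mathbf A$, and $\mathbf u_0\in\mathbb C^M$, $\mathbf v_0\in\mathbb C^N$ denote the normalized singular vectors corresponding to $\sigma_0$, determined by $\mathbf A\mathbf A^*\mathbf u_0=\sigma_0^2\mathbf u_0$, $\mathbf A^*\mathbf A\mathbf v_0=\sigma_0^2\mathbf v_0$, $\mathbf u_0=\frac1{\sigma_0}\mathbf A\mathbf v_0$, $\mathbf v_0=\frac1{\sigma_0}\mathbf A^*\mathbf u_0$.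
   Formalization: The equalities for u_0 and v_0 are taken up to unimodular factors, and for some singular vector pair if σ_0 is multiple. Taken literally with u_0 = A v_0/σ_0 the claim fails, e.g. for A with sole nonzero entry a_{0,0} = -1 (error 0, but c~ = -1). *)

theory Defs
  imports "Jordan_Normal_Form.Spectral_Radius" "Jordan_Normal_Form.Schur_Decomposition"
begin

definition vec_norm2 :: "complex vec \<Rightarrow> real" where
  "vec_norm2 x = sqrt (\<Sum>i<dim_vec x. (cmod (x $ i))\<^sup>2)"

definition frobenius_norm :: "complex mat \<Rightarrow> real" where
  "frobenius_norm A = sqrt (\<Sum>i<dim_row A. \<Sum>j<dim_col A. (cmod (A $$ (i, j)))\<^sup>2)"

text \<open>The operator norm induced by the Euclidean norms; meaningful for matrices with at
  least one column, as otherwise the supremum is taken over the empty set.\<close>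

definition spectral_norm :: "complex mat \<Rightarrow> real" where
  "spectral_norm A =
     Sup {vec_norm2 (A *\<^sub>v x) | x. x \<in> carrier_vec (dim_col A) \<and> vec_norm2 x = 1}"

text \<open>If \<open>A\<close> has more columns than rows, \<open>A\<^sup>*A\<close> contributes additional zeros to the usual
  list of singular values; this does not affect the largest one.\<close>

definition singular_values :: "complex mat \<Rightarrow> real set" where
  "singular_values A = {s. s \<ge> 0 \<and> eigenvalue (mat_adjoint A * A) (complex_of_real (s\<^sup>2))}"

definition largest_singular_value :: "complex mat \<Rightarrow> real" where
  "largest_singular_value A = Max (singular_values A)"

text \<open>The conditions determine \<open>(u, v)\<close> at best up to a common factor of modulus one.\<close>

definition singular_vector_pair ::
  "complex mat \<Rightarrow> real \<Rightarrow> complex vec \<Rightarrow> complex vec \<Rightarrow> bool" where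
  "singular_vector_pair A s u v \<longleftrightarrow>
     u \<in> carrier_vec (dim_row A) \<and> v \<in> carrier_vec (dim_col A) \<and>
     vec_norm2 u = 1 \<and> vec_norm2 v = 1 \<and>
     (A * mat_adjoint A) *\<^sub>v u = complex_of_real (s\<^sup>2) \<cdot>\<^sub>v u \<and>
     (mat_adjoint A * A) *\<^sub>v v = complex_of_real (s\<^sup>2) \<cdot>\<^sub>v v \<and>
     u = complex_of_real (1 / s) \<cdot>\<^sub>v (A *\<^sub>v v) \<and>
     v = complex_of_real (1 / s) \<cdot>\<^sub>v (mat_adjoint A *\<^sub>v u)"

definition zvec :: "nat \<Rightarrow> complex \<Rightarrow> complex vec" where
  "zvec n z = vec n (\<lambda>k. complex_of_real (1 / sqrt (\<Sum>l<n. cmod z ^ (2 * l))) * z ^ k)"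

definition outer_prod :: "complex vec \<Rightarrow> complex vec \<Rightarrow> complex mat" where
  "outer_prod x y = mat (dim_vec x) (dim_vec y) (\<lambda>(i, j). x $ i * y $ j)"

definition hankel_rank1 :: "nat \<Rightarrow> nat \<Rightarrow> complex \<Rightarrow> complex \<Rightarrow> complex mat" where
  "hankel_rank1 M N c z = c \<cdot>\<^sub>m outer_prod (zvec M z) (zvec N z)"

text \<open>The number \<open>z\<^sub>M(z)\<^sup>* A conj(z\<^sub>N(z))\<close>; note that \<open>\<bullet>c\<close> conjugates its second argument.\<close>

definition hankel_coeff :: "complex mat \<Rightarrow> complex \<Rightarrow> complex" where
  "hankel_coeff A z =
     (A *\<^sub>v conjugate (zvec (dim_col A) z)) \<bullet>c zvec (dim_row A) z"

end

theory Submission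
  imports "HOL-Analysis.Topology_Euclidean_Space" Defs
begin

text \<open>For unit vectors \<open>x, y\<close> put \<open>h = x\<^sup>* A y'\<close>, where \<open>y'\<close> is the conjugate of \<open>y\<close>. Expanding the
  square gives \<open>\<parallel>A - c x y\<^sup>T\<parallel>\<^sub>F\<^sup>2 = \<parallel>A\<parallel>\<^sub>F\<^sup>2 - \<bar>h\<bar>\<^sup>2 + \<bar>c - h\<bar>\<^sup>2\<close>, so the best error is governed by
  the maximum of \<open>\<bar>h\<bar>\<close> and equals \<open>\<parallel>A\<parallel>\<^sub>F\<^sup>2 - \<parallel>A\<parallel>\<^sub>2\<^sup>2\<close> iff \<open>\<bar>h\<bar> = \<parallel>A\<parallel>\<^sub>2\<close>. The latter is the equality
  case of Cauchy--Schwarz, which forces \<open>A y' = h x\<close> and \<open>A\<^sup>* x = h' y'\<close> with \<open>h'\<close> the conjugate of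
  \<open>h\<close>; that is, \<open>x\<close> and \<open>y'\<close> are singular vectors up to phases.\<close>

unbundle no inner_syntax and no vec_syntax

section \<open>Euclidean norm and inner product on complex vectors\<close>

lemma cscalar_prod_sum:
  fixes x y :: "complex vec"
  assumes "dim_vec y = n"
  shows "x \<bullet>c y = (\<Sum>i<n. x $ i * cnj (y $ i))"
  using assms by (simp add: scalar_prod_def conjugate_complex_def lessThan_atLeast0)

lemma vec_norm2_sq: "(vec_norm2 x)\<^sup>2 = (\<Sum>i<dim_vec x. (cmod (x $ i))\<^sup>2)"
  by (simp add: vec_norm2_def sum_nonneg)

lemma vec_norm2_nonneg [simp]: "vec_norm2 x \<ge> 0"
  by (simp add: vec_norm2_def sum_nonneg)

lemma cscalar_prod_self: "x \<bullet>c x = complex_of_real ((vec_norm2 x)\<^sup>2)"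
  by (simp add: cscalar_prod_sum[OF refl] vec_norm2_sq complex_norm_square del: of_real_power)

lemma vec_norm2_eq_0_iff: "vec_norm2 x = 0 \<longleftrightarrow> x = 0\<^sub>v (dim_vec x)"
proof -
  have "vec_norm2 x = 0 \<longleftrightarrow> (\<forall>i<dim_vec x. x $ i = 0)"
    by (auto simp: vec_norm2_def sum_nonneg_eq_0_iff)
  then show ?thesis by (auto intro!: eq_vecI) (metis index_zero_vec(1))
qed

lemma vec_norm2_smult: "vec_norm2 (c \<cdot>\<^sub>v x) = cmod c * vec_norm2 x"
  by (simp add: vec_norm2_def norm_mult power_mult_distrib sum_distrib_left[symmetric]
      real_sqrt_mult)

lemma cmod_diff_sq: "(cmod (a - b))\<^sup>2 = (cmod a)\<^sup>2 - 2 * Re (cnj b * a) + (cmod b)\<^sup>2"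
  by (simp only: cmod_power2) (simp add: power2_eq_square algebra_simps)

text \<open>The one expansion behind Cauchy-Schwarz, its equality case and the residual estimate for
  an approximate eigenvector.\<close>

lemma vec_norm2_diff_smult:
  assumes "x \<in> carrier_vec n" "y \<in> carrier_vec n"
  shows "(vec_norm2 (x - c \<cdot>\<^sub>v y))\<^sup>2 =
    (vec_norm2 x)\<^sup>2 - 2 * Re (cnj c * (x \<bullet>c y)) + (cmod c)\<^sup>2 * (vec_norm2 y)\<^sup>2"
proof -
  have "(vec_norm2 (x - c \<cdot>\<^sub>v y))\<^sup>2 = (\<Sum>i<n. (cmod (x $ i - c * y $ i))\<^sup>2)"
    using assms by (simp add: vec_norm2_sq)
  also have "\<dots> = (\<Sum>i<n. (cmod (x $ i))\<^sup>2 - 2 * Re (cnj c * (x $ i * cnj (y $ i)))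
      + (cmod c)\<^sup>2 * (cmod (y $ i))\<^sup>2)"
    by (simp only: cmod_diff_sq norm_mult power_mult_distrib complex_cnj_mult mult.assoc)
       (simp only: mult.commute mult.left_commute)
  also have "\<dots> = (\<Sum>i<n. (cmod (x $ i))\<^sup>2)
      - 2 * Re (cnj c * (\<Sum>i<n. x $ i * cnj (y $ i)))
      + (cmod c)\<^sup>2 * (\<Sum>i<n. (cmod (y $ i))\<^sup>2)"
    by (simp only: sum.distrib sum_subtractf sum_distrib_left Re_sum)
  finally show ?thesis
    using assms by (simp add: vec_norm2_sq cscalar_prod_sum[of y n])
qed

lemma norm_cscalar_prod_le:
  assumes "x \<in> carrier_vec n" "y \<in> carrier_vec n"
  shows "cmod (x \<bullet>c y) \<le> vec_norm2 x * vec_norm2 y"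
proof (cases "vec_norm2 y = 0")
  case True
  then have "y = 0\<^sub>v n" using assms by (simp add: vec_norm2_eq_0_iff)
  then show ?thesis using assms by (simp add: vec_norm2_eq_0_iff cscalar_prod_sum[of _ n])
next
  case False
  define h where "h = x \<bullet>c y"
  define t where "t = (vec_norm2 y)\<^sup>2"
  have t: "t > 0" using False by (simp add: t_def)
  \<comment> \<open>The factor \<open>h / t\<close> makes the subtracted multiple of
    \<open>y\<close> the orthogonal projection of \<open>x\<close>.\<close>
  have "0 \<le> (vec_norm2 (x - (h / of_real t) \<cdot>\<^sub>v y))\<^sup>2" by simp
  also have "\<dots> = (vec_norm2 x)\<^sup>2 - 2 * Re (cnj (h / of_real t) * h)
      + (cmod (h / of_real t))\<^sup>2 * t"
    unfolding vec_norm2_diff_smult[OF assms] h_def t_def ..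
  also have "cnj (h / of_real t) * h = of_real ((cmod h)\<^sup>2 / t)"
    by (simp add: complex_norm_square mult.commute del: of_real_power)
  also have "(cmod (h / of_real t))\<^sup>2 * t = (cmod h)\<^sup>2 / t"
    using t by (simp add: norm_divide power_divide power2_eq_square)
  finally have "(cmod h)\<^sup>2 \<le> (vec_norm2 x)\<^sup>2 * t" using t by (simp add: field_simps)
  then have "(cmod h)\<^sup>2 \<le> (vec_norm2 x * vec_norm2 y)\<^sup>2"
    by (simp add: t_def power_mult_distrib)
  then show ?thesis unfolding h_def by (rule power2_le_imp_le) simp
qed

section \<open>The adjoint and the Frobenius bound\<close>

lemma mat_adjoint_carrier [simp]:
  "A \<in> carrier_mat m n \<Longrightarrow> mat_adjoint A \<in> carrier_mat n m"
  by (auto simp: mat_adjoint_def)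

lemma mat_adjoint_index:
  fixes A :: "complex mat"
  assumes "A \<in> carrier_mat m n" "i < n" "j < m"
  shows "mat_adjoint A $$ (i, j) = cnj (A $$ (j, i))"
  using assms by (simp add: mat_adjoint_def mat_of_rows_def conjugate_complex_def)

lemma mult_mat_vec_sum:
  fixes A :: "complex mat"
  assumes "A \<in> carrier_mat m n" "v \<in> carrier_vec n" "i < m"
  shows "(A *\<^sub>v v) $ i = (\<Sum>j<n. A $$ (i, j) * v $ j)"
  using assms by (simp add: scalar_prod_def lessThan_atLeast0)

lemma cscalar_prod_adjoint:
  fixes A :: "complex mat"
  assumes A: "A \<in> carrier_mat m n" and v: "v \<in> carrier_vec n" and u: "u \<in> carrier_vec m"
  shows "(A *\<^sub>v v) \<bullet>c u = v \<bullet>c (mat_adjoint A *\<^sub>v u)"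
proof -
  have "(A *\<^sub>v v) \<bullet>c u = (\<Sum>i<m. \<Sum>j<n. A $$ (i, j) * v $ j * cnj (u $ i))"
    using u by (simp add: cscalar_prod_sum[of u m] mult_mat_vec_sum[OF A v] sum_distrib_right
        del: index_mult_mat_vec)
  also have "\<dots> = (\<Sum>j<n. \<Sum>i<m. A $$ (i, j) * v $ j * cnj (u $ i))" by (rule sum.swap)
  also have "\<dots> = (\<Sum>j<n. v $ j * cnj ((mat_adjoint A *\<^sub>v u) $ j))"
    using u by (simp add: mult_mat_vec_sum[OF mat_adjoint_carrier[OF A] u]
        mat_adjoint_index[OF A] sum_distrib_left ac_simps del: index_mult_mat_vec)
  also have "\<dots> = v \<bullet>c (mat_adjoint A *\<^sub>v u)"
    using mat_adjoint_carrier[OF A] by (simp add: cscalar_prod_sum[of _ n])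
  finally show ?thesis .
qed

lemma cscalar_prod_swap:
  fixes x y :: "complex vec"
  assumes "x \<in> carrier_vec n" "y \<in> carrier_vec n"
  shows "y \<bullet>c x = cnj (x \<bullet>c y)"
  using assms by (simp add: cscalar_prod_sum[of _ n] mult.commute)

text \<open>Cauchy-Schwarz applied to each row. It makes the set under the supremum in
  \<open>spectral_norm\<close> bounded, and later bounds an inverse matrix.\<close>

lemma vec_norm2_mult_le_frobenius:
  assumes A: "A \<in> carrier_mat m n" and v: "v \<in> carrier_vec n"
  shows "vec_norm2 (A *\<^sub>v v) \<le> frobenius_norm A * vec_norm2 v"
proof -
  have row: "(cmod ((A *\<^sub>v v) $ i))\<^sup>2 \<le> (\<Sum>j<n. (cmod (A $$ (i, j)))\<^sup>2) * (vec_norm2 v)\<^sup>2"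
    if i: "i < m" for i
  proof -
    have "(A *\<^sub>v v) $ i = row A i \<bullet>c conjugate v" using A i v by simp
    then have "cmod ((A *\<^sub>v v) $ i) \<le> vec_norm2 (row A i) * vec_norm2 (conjugate v)"
      using norm_cscalar_prod_le[of "row A i" n "conjugate v"] A i v by simp
    moreover have "vec_norm2 (conjugate v) = vec_norm2 v"
      by (simp add: vec_norm2_def conjugate_complex_def)
    ultimately have "(cmod ((A *\<^sub>v v) $ i))\<^sup>2 \<le> (vec_norm2 (row A i) * vec_norm2 v)\<^sup>2"
      by (intro power_mono) auto
    also have "\<dots> = (\<Sum>j<n. (cmod (A $$ (i, j)))\<^sup>2) * (vec_norm2 v)\<^sup>2"
      using A i by (simp add: power_mult_distrib vec_norm2_sq)
    finally show ?thesis .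
  qed
  have "(vec_norm2 (A *\<^sub>v v))\<^sup>2 = (\<Sum>i<m. (cmod ((A *\<^sub>v v) $ i))\<^sup>2)"
    using A by (simp add: vec_norm2_sq)
  also have "\<dots> \<le> (\<Sum>i<m. (\<Sum>j<n. (cmod (A $$ (i, j)))\<^sup>2) * (vec_norm2 v)\<^sup>2)"
    by (intro sum_mono row) simp
  also have "\<dots> = (frobenius_norm A * vec_norm2 v)\<^sup>2"
    using A by (simp add: frobenius_norm_def power_mult_distrib sum_distrib_right sum_nonneg)
  finally show ?thesis
    by (rule power2_le_imp_le) (simp add: frobenius_norm_def sum_nonneg)
qed

section \<open>The spectral norm as an operator norm\<close>

lemma spectral_norm_upper:
  assumes A: "A \<in> carrier_mat m n" and v: "v \<in> carrier_vec n"
  shows "vec_norm2 (A *\<^sub>v v) \<le> spectral_norm A * vec_norm2 v"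
proof (cases "vec_norm2 v = 0")
  case True
  then show ?thesis using vec_norm2_mult_le_frobenius[OF assms] by simp
next
  case False
  let ?X = "{vec_norm2 (A *\<^sub>v x) | x. x \<in> carrier_vec (dim_col A) \<and> vec_norm2 x = 1}"
  define w where "w = complex_of_real (1 / vec_norm2 v) \<cdot>\<^sub>v v"
  have w: "w \<in> carrier_vec n" "vec_norm2 w = 1"
    using v False by (simp_all add: w_def vec_norm2_smult norm_divide)
  have "bdd_above ?X"
    using vec_norm2_mult_le_frobenius[OF A] A by (auto intro!: bdd_aboveI[of _ "frobenius_norm A"]) fastforce
  then have "vec_norm2 (A *\<^sub>v w) \<le> spectral_norm A"
    unfolding spectral_norm_def using w A by (intro cSup_upper) auto
  moreover have "vec_norm2 (A *\<^sub>v w) = vec_norm2 (A *\<^sub>v v) / vec_norm2 v"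
    using A v by (simp add: w_def mult_mat_vec vec_norm2_smult norm_divide)
  ultimately show ?thesis using False by (simp add: field_simps order_less_le)
qed

lemma vec_norm2_unit_vec: "i < n \<Longrightarrow> vec_norm2 (unit_vec n i) = 1"
  by (simp add: vec_norm2_def unit_vec_def if_distrib[of "\<lambda>x. (cmod x)\<^sup>2"] cong: if_cong)

text \<open>Positivity of \<open>n\<close> supplies a unit vector, so the supremum is over a
  nonempty set.\<close>

lemma spectral_norm_least:
  assumes A: "A \<in> carrier_mat m n" and n: "n > 0"
    and "\<And>v. v \<in> carrier_vec n \<Longrightarrow> vec_norm2 v = 1 \<Longrightarrow> vec_norm2 (A *\<^sub>v v) \<le> b"
  shows "spectral_norm A \<le> b"
  unfolding spectral_norm_def using assms vec_norm2_unit_vec[OF n] 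
  by (intro cSup_least) (auto intro: exI[of _ "unit_vec n 0"])

lemma spectral_norm_nonneg:
  assumes A: "A \<in> carrier_mat m n" and n: "n > 0"
  shows "spectral_norm A \<ge> 0"
  using order_trans[OF vec_norm2_nonneg spectral_norm_upper[OF A unit_vec_carrier, of 0]]
  by (simp add: vec_norm2_unit_vec[OF n])

text \<open>A nonzero entry lies in a nonzero column, which is the image of a unit vector.\<close>

lemma spectral_norm_pos:
  assumes A: "A \<in> carrier_mat m n" and "A \<noteq> 0\<^sub>m m n"
  shows "spectral_norm A > 0"
proof -
  obtain i j where ij: "i < m" "j < n" "A $$ (i, j) \<noteq> 0"
    using assms by (metis carrier_matD eq_matI index_zero_mat)
  have "(A *\<^sub>v unit_vec n j) $ i \<noteq> 0" using A ij by simp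
  then have "A *\<^sub>v unit_vec n j \<noteq> 0\<^sub>v m" using ij by auto
  then have "vec_norm2 (A *\<^sub>v unit_vec n j) \<noteq> 0" using A by (simp add: vec_norm2_eq_0_iff)
  then have "vec_norm2 (A *\<^sub>v unit_vec n j) > 0"
    using vec_norm2_nonneg[of "A *\<^sub>v unit_vec n j"] by linarith
  also have "\<dots> \<le> spectral_norm A"
    using spectral_norm_upper[OF A unit_vec_carrier] vec_norm2_unit_vec[OF ij(2)] by (metis mult.right_neutral)
  finally show ?thesis .
qed

text \<open>With \<open>w = mat_adjoint A *\<^sub>v u\<close>, the squared norm of \<open>w\<close>
  is the inner product of \<open>A *\<^sub>v w\<close> with \<open>u\<close>; Cauchy-Schwarz and
  cancelling one factor \<open>vec_norm2 w\<close> give the bound.\<close>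

lemma vec_norm2_adjoint_le:
  assumes A: "A \<in> carrier_mat m n" and n: "n > 0" and u: "u \<in> carrier_vec m"
  shows "vec_norm2 (mat_adjoint A *\<^sub>v u) \<le> spectral_norm A * vec_norm2 u"
proof -
  define w where "w = mat_adjoint A *\<^sub>v u"
  have w: "w \<in> carrier_vec n" using mat_adjoint_carrier[OF A] u by (auto simp: w_def)
  have Aw: "A *\<^sub>v w \<in> carrier_vec m" using A w by auto
  have "(vec_norm2 w)\<^sup>2 = cmod (w \<bullet>c w)" by (simp add: cscalar_prod_self norm_power)
  also have "w \<bullet>c w = (A *\<^sub>v w) \<bullet>c u" using cscalar_prod_adjoint[OF A w u] by (simp add: w_def)
  also have "cmod \<dots> \<le> vec_norm2 (A *\<^sub>v w) * vec_norm2 u" by (rule norm_cscalar_prod_le[OF Aw u])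
  also have "\<dots> \<le> (spectral_norm A * vec_norm2 w) * vec_norm2 u"
    by (intro mult_right_mono spectral_norm_upper[OF A w]) simp
  finally have "vec_norm2 w * vec_norm2 w \<le> vec_norm2 w * (spectral_norm A * vec_norm2 u)"
    by (simp add: power2_eq_square ac_simps)
  moreover have "0 \<le> spectral_norm A * vec_norm2 u" using spectral_norm_nonneg[OF A n] by simp
  ultimately show ?thesis unfolding w_def[symmetric]
    by (cases "vec_norm2 w = 0") (auto simp: mult_le_cancel_left)
qed


section \<open>The largest singular value equals the spectral norm\<close>

text \<open>The supremum \<open>S\<close> defining the spectral norm need not be attained a priori, so compactness is
  bypassed: with \<open>B = A\<^sup>*A\<close>, every unit vector \<open>v\<close> satisfies
  \<open>\<parallel>Bv - S\<^sup>2v\<parallel>\<^sup>2 \<le> S\<^sup>2 (S\<^sup>2 - \<parallel>Av\<parallel>\<^sup>2)\<close>, and an inverse of \<open>B - S\<^sup>2\<close> would keep the left-hand side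
  away from \<open>0\<close>.\<close>

lemma eigenvalue_spectral_norm:
  assumes A: "A \<in> carrier_mat m n" and n: "n > 0"
  shows "eigenvalue (mat_adjoint A * A) (complex_of_real ((spectral_norm A)\<^sup>2))"
proof (rule ccontr)
  assume no: "\<not> ?thesis"
  define S where "S = spectral_norm A"
  define B where "B = mat_adjoint A * A"
  define Q where "Q = char_matrix B (complex_of_real (S\<^sup>2))"
  note adj = mat_adjoint_carrier[OF A]
  have B: "B \<in> carrier_mat n n" unfolding B_def by (rule mult_carrier_mat[OF adj A])
  have Q: "Q \<in> carrier_mat n n" using B by (simp add: Q_def)
  \<comment> \<open>\<open>Q\<close> is \<open>B\<close> minus \<open>S\<^sup>2\<close> times the
    identity, so it is invertible unless \<open>S\<^sup>2\<close> is an eigenvalue.\<close>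
  have "det Q \<noteq> 0" using no eigenvalue_det[OF B] by (simp add: Q_def B_def S_def)
  from det_non_zero_imp_unit[OF Q this, of "()"]
  obtain R where R: "R \<in> carrier_mat n n" "R * Q = 1\<^sub>m n"
    by (auto simp: Units_def ring_mat_simps)
  define K where "K = (frobenius_norm R)\<^sup>2 * S\<^sup>2"
  have gap: "1 \<le> K * (S\<^sup>2 - (vec_norm2 (A *\<^sub>v v))\<^sup>2)"
    if v: "v \<in> carrier_vec n" "vec_norm2 v = 1" for v
  proof -
    have Av: "A *\<^sub>v v \<in> carrier_vec m" using A v by auto
    have Bv: "B *\<^sub>v v = mat_adjoint A *\<^sub>v (A *\<^sub>v v)" 
      unfolding B_def by (rule assoc_mult_mat_vec[OF adj A v(1)])
    have Bv_carrier: "B *\<^sub>v v \<in> carrier_vec n" using B v by auto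
    have Qv: "Q *\<^sub>v v = B *\<^sub>v v - complex_of_real (S\<^sup>2) \<cdot>\<^sub>v v"
      using B v by (intro eq_vecI) (simp_all add: Q_def char_matrix_def add_mult_distrib_mat_vec[of _ n n])
    \<comment> \<open>The inverse \<open>R\<close> turns the unit length of \<open>v\<close> into a
      lower bound on the residual \<open>Q *\<^sub>v v\<close>.\<close>
    have "v = R *\<^sub>v (Q *\<^sub>v v)" using R Q v by (simp flip: assoc_mult_mat_vec)
    then have "1 \<le> frobenius_norm R * vec_norm2 (Q *\<^sub>v v)"
      using vec_norm2_mult_le_frobenius[OF R(1), of "Q *\<^sub>v v"] Q v by simp
    then have "1 \<le> (frobenius_norm R)\<^sup>2 * (vec_norm2 (Q *\<^sub>v v))\<^sup>2"
      by (metis one_le_power power_mult_distrib)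
    \<comment> \<open>The expanded square is the squared norm of \<open>B *\<^sub>v v\<close>, minus
      \<open>2 * S\<^sup>2\<close> times that of \<open>A *\<^sub>v v\<close>, plus
      \<open>S ^ 4\<close>; the first term is at most \<open>S\<^sup>2\<close> times the squared
      norm of \<open>A *\<^sub>v v\<close>.\<close>
    moreover have "(vec_norm2 (Q *\<^sub>v v))\<^sup>2 \<le> S\<^sup>2 * (S\<^sup>2 - (vec_norm2 (A *\<^sub>v v))\<^sup>2)"
    proof -
      have "vec_norm2 (B *\<^sub>v v) \<le> S * vec_norm2 (A *\<^sub>v v)"
        unfolding Bv S_def by (rule vec_norm2_adjoint_le[OF A n Av])
      then have "(vec_norm2 (B *\<^sub>v v))\<^sup>2 \<le> S\<^sup>2 * (vec_norm2 (A *\<^sub>v v))\<^sup>2"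
        by (metis power_mono power_mult_distrib vec_norm2_nonneg)
      moreover have "v \<bullet>c (B *\<^sub>v v) = complex_of_real ((vec_norm2 (A *\<^sub>v v))\<^sup>2)"
        using cscalar_prod_adjoint[OF A v(1) Av] by (simp only: Bv cscalar_prod_self)
      then have "(B *\<^sub>v v) \<bullet>c v = complex_of_real ((vec_norm2 (A *\<^sub>v v))\<^sup>2)"
        using cscalar_prod_swap[OF v(1) Bv_carrier] by (simp only: complex_cnj_complex_of_real)
      ultimately show ?thesis
        unfolding Qv vec_norm2_diff_smult[OF Bv_carrier v(1)]
        by (simp add: v(2) norm_power power2_eq_square algebra_simps flip: of_real_mult)
    qed
    ultimately show ?thesis unfolding K_def
      by (smt (verit, best) mult.assoc mult_left_mono zero_le_power2)
  qed
  have K: "K > 0"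
  proof -
    \<comment> \<open>For \<open>K = 0\<close> the gap estimate at a unit vector would read
      \<open>1 \<le> 0\<close>.\<close>
    have "K \<noteq> 0" using gap[OF unit_vec_carrier vec_norm2_unit_vec[OF n]] by auto
    then show ?thesis by (simp add: K_def zero_less_mult_iff)
  qed
  have bound: "(vec_norm2 (A *\<^sub>v v))\<^sup>2 \<le> S\<^sup>2 - 1 / K"
    if v: "v \<in> carrier_vec n" "vec_norm2 v = 1" for v
    using gap[OF v] K by (simp add: field_simps)
  \<comment> \<open>Needed to square the root below, since \<open>sqrt\<close> is negative on
    negative arguments.\<close>
  have nonneg: "0 \<le> S\<^sup>2 - 1 / K"
    using order_trans[OF zero_le_power2 bound[OF unit_vec_carrier vec_norm2_unit_vec[OF n]]] .
  \<comment> \<open>The bound is uniform in \<open>v\<close>, so it passes to the supremum and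
    pushes \<open>S\<close> strictly below itself.\<close>
  have "S \<le> sqrt (S\<^sup>2 - 1 / K)"
    unfolding S_def by (rule spectral_norm_least[OF A n]) (use bound in \<open>auto simp: S_def intro: real_le_rsqrt\<close>)
  then have "S\<^sup>2 \<le> S\<^sup>2 - 1 / K"
    using spectral_norm_nonneg[OF A n] nonneg by (metis S_def power_mono real_sqrt_pow2)
  then show False using K by simp
qed

text \<open>Pairing the eigenvalue equation with its eigenvector \<open>v\<close> shows that
  \<open>A\<close> stretches \<open>v\<close> by exactly \<open>s\<close>.\<close>

lemma singular_value_le_spectral_norm:
  assumes A: "A \<in> carrier_mat m n" and n: "n > 0" and s: "s \<in> singular_values A"
  shows "s \<le> spectral_norm A"
proof -
  note adj = mat_adjoint_carrier[OF A]
  have B: "mat_adjoint A * A \<in> carrier_mat n n" by (rule mult_carrier_mat[OF adj A])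
  obtain v where v: "v \<in> carrier_vec n" "v \<noteq> 0\<^sub>v n"
    and ev: "(mat_adjoint A * A) *\<^sub>v v = complex_of_real (s\<^sup>2) \<cdot>\<^sub>v v" and s0: "s \<ge> 0"
    using s B unfolding singular_values_def eigenvalue_def eigenvector_def by auto
  have Av: "A *\<^sub>v v \<in> carrier_vec m" using A v by auto
  have pos: "vec_norm2 v > 0"
    using v vec_norm2_nonneg[of v] by (auto simp: vec_norm2_eq_0_iff order_less_le)
  have "complex_of_real ((vec_norm2 (A *\<^sub>v v))\<^sup>2) = v \<bullet>c (mat_adjoint A *\<^sub>v (A *\<^sub>v v))"
    using cscalar_prod_adjoint[OF A v(1) Av] by (simp add: cscalar_prod_self)
  also have "mat_adjoint A *\<^sub>v (A *\<^sub>v v) = complex_of_real (s\<^sup>2) \<cdot>\<^sub>v v"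
    using ev adj A v by simp
  also have "v \<bullet>c \<dots> = complex_of_real ((s * vec_norm2 v)\<^sup>2)"
    using cscalar_prod_self[of v] v
    by (simp add: conjugate_smult_vec conjugate_complex_def power_mult_distrib)
  finally have "(vec_norm2 (A *\<^sub>v v))\<^sup>2 = (s * vec_norm2 v)\<^sup>2" by (simp only: of_real_eq_iff)
  then have "vec_norm2 (A *\<^sub>v v) = s * vec_norm2 v"
    using s0 pos by (simp add: power2_eq_iff_nonneg)
  then show ?thesis using spectral_norm_upper[OF A v(1)] pos by simp
qed

text \<open>Squaring is injective on nonnegative reals and maps singular values into a finite
  spectrum; this makes \<open>Max\<close> meaningful.\<close>

lemma finite_singular_values:
  assumes A: "A \<in> carrier_mat m n"
  shows "finite (singular_values A)"
proof -
  have B: "mat_adjoint A * A \<in> carrier_mat n n"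
    by (rule mult_carrier_mat[OF mat_adjoint_carrier[OF A] A])
  have "(\<lambda>s. complex_of_real (s\<^sup>2)) ` singular_values A \<subseteq> spectrum (mat_adjoint A * A)"
    by (auto simp: singular_values_def spectrum_def)
  then have "finite ((\<lambda>s. complex_of_real (s\<^sup>2)) ` singular_values A)"
    using card_finite_spectrum(1)[OF B] finite_subset by blast
  moreover have "inj_on (\<lambda>s. complex_of_real (s\<^sup>2)) (singular_values A)"
    by (auto simp: inj_on_def singular_values_def power2_eq_iff_nonneg simp del: of_real_power)
  ultimately show ?thesis by (rule finite_imageD)
qed

lemma largest_singular_value_eq:
  assumes A: "A \<in> carrier_mat m n" and n: "n > 0"
  shows "largest_singular_value A = spectral_norm A"
  unfolding largest_singular_value_def
  using finite_singular_values[OF A] singular_value_le_spectral_norm[OF A n]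
    eigenvalue_spectral_norm[OF A n] spectral_norm_nonneg[OF A n]
  by (intro Max_eqI) (auto simp: singular_values_def)

section \<open>Rank-1 approximation error and singular vector pairs\<close>

text \<open>Pythagoras: \<open>h\<close> is the Frobenius inner product of \<open>A\<close> with
  \<open>outer_prod x y\<close>, which has Frobenius norm one.\<close>

lemma frobenius_norm_diff_outer_prod:
  assumes A: "A \<in> carrier_mat m n"
    and x: "x \<in> carrier_vec m" "vec_norm2 x = 1" and y: "y \<in> carrier_vec n" "vec_norm2 y = 1"
  defines "h \<equiv> (A *\<^sub>v conjugate y) \<bullet>c x"
  shows "(frobenius_norm (A - c \<cdot>\<^sub>m outer_prod x y))\<^sup>2 =
    (frobenius_norm A)\<^sup>2 - (cmod h)\<^sup>2 + (cmod (c - h))\<^sup>2"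
proof -
  let ?b = "\<lambda>i j. A $$ (i, j) * cnj (y $ j) * cnj (x $ i)"
  have cy: "conjugate y \<in> carrier_vec n" using y by simp
  have h: "h = (\<Sum>i<m. \<Sum>j<n. ?b i j)"
    using x y unfolding h_def
    by (simp add: cscalar_prod_sum[of x m] mult_mat_vec_sum[OF A cy] sum_distrib_right
        conjugate_complex_def del: index_mult_mat_vec)
  have "(frobenius_norm (A - c \<cdot>\<^sub>m outer_prod x y))\<^sup>2 =
      (\<Sum>i<m. \<Sum>j<n. (cmod (A $$ (i, j) - c * (x $ i * y $ j)))\<^sup>2)"
    using A x y by (simp add: frobenius_norm_def outer_prod_def sum_nonneg)
  also have "\<dots> = (\<Sum>i<m. \<Sum>j<n. (cmod (A $$ (i, j)))\<^sup>2 - 2 * Re (cnj c * ?b i j)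
      + (cmod c)\<^sup>2 * ((cmod (x $ i))\<^sup>2 * (cmod (y $ j))\<^sup>2))"
    by (simp only: cmod_diff_sq norm_mult power_mult_distrib complex_cnj_mult)
       (simp only: mult.assoc mult.commute mult.left_commute)
  also have "\<dots> = (\<Sum>i<m. \<Sum>j<n. (cmod (A $$ (i, j)))\<^sup>2) - 2 * Re (cnj c * h)
      + (cmod c)\<^sup>2 * ((\<Sum>i<m. (cmod (x $ i))\<^sup>2) * (\<Sum>j<n. (cmod (y $ j))\<^sup>2))"
    unfolding h sum_product by (simp only: sum.distrib sum_subtractf sum_distrib_left Re_sum)
  also have "\<dots> = (frobenius_norm A)\<^sup>2 - 2 * Re (cnj c * h) + (cmod c)\<^sup>2"
    using A x y vec_norm2_sq[of x] vec_norm2_sq[of y]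
    by (simp add: frobenius_norm_def sum_nonneg)
  finally show ?thesis by (simp add: cmod_diff_sq mult.commute)
qed

text \<open>Only the relative phase of the two vectors matters: \<open>w\<close> is kept and
  \<open>x\<close> absorbs the phase of \<open>h\<close>.\<close>

lemma singular_vector_pair_of_maximal:
  assumes A: "A \<in> carrier_mat m n" and n: "n > 0"
    and x: "x \<in> carrier_vec m" "vec_norm2 x = 1" and w: "w \<in> carrier_vec n" "vec_norm2 w = 1"
    and h: "h = (A *\<^sub>v w) \<bullet>c x" and S: "cmod h = S" "S = spectral_norm A" "S > 0"
  shows "singular_vector_pair A S ((h / complex_of_real S) \<cdot>\<^sub>v x) w"
proof -
  note adj = mat_adjoint_carrier[OF A]
  \<comment> \<open>the equality case of the Cauchy--Schwarz inequality\<close>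
  have eq_of_norm: "p = c \<cdot>\<^sub>v q"
    if "p \<in> carrier_vec k" "q \<in> carrier_vec k" "vec_norm2 q = 1" "p \<bullet>c q = c"
      "cmod c = S" "vec_norm2 p \<le> S" for p q k c
  proof -
    \<comment> \<open>This is the form into which simplification brings
      \<open>Re (cnj c * c)\<close>.\<close>
    have "Re c * Re c + Im c * Im c = S\<^sup>2"
      by (simp add: cmod_power2 flip: that(5)) (simp add: power2_eq_square)
    then have "(vec_norm2 (p - c \<cdot>\<^sub>v q))\<^sup>2 = (vec_norm2 p)\<^sup>2 - S\<^sup>2"
      using vec_norm2_diff_smult[OF that(1,2), of c] that(3-5) by simp
    also have "\<dots> \<le> 0" using that(6) by (simp add: power_mono)
    finally have "p - c \<cdot>\<^sub>v q = 0\<^sub>v k" using that by (simp add: vec_norm2_eq_0_iff)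
    then show ?thesis using that(1,2)
      by (intro eq_vecI) (auto dest!: arg_cong[of _ _ "\<lambda>v. v $ _"] simp: vec_eq_iff)
  qed
  have Aw_carrier: "A *\<^sub>v w \<in> carrier_vec m" and Ax_carrier: "mat_adjoint A *\<^sub>v x \<in> carrier_vec n"
    using A w mult_mat_vec_carrier[OF adj x(1)] by auto
  have Aw: "A *\<^sub>v w = h \<cdot>\<^sub>v x"
    using spectral_norm_upper[OF A w(1)] w(2) S
    by (intro eq_of_norm[OF Aw_carrier x]) (auto simp: h)
  have "(mat_adjoint A *\<^sub>v x) \<bullet>c w = cnj h"
    using cscalar_prod_swap[OF w(1) Ax_carrier] cscalar_prod_adjoint[OF A w(1) x(1)] h by simp
  then have Ax: "mat_adjoint A *\<^sub>v x = cnj h \<cdot>\<^sub>v w"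
    using vec_norm2_adjoint_le[OF A n x(1)] x(2) S
    by (intro eq_of_norm[OF Ax_carrier w]) auto
  define u where "u = (h / complex_of_real S) \<cdot>\<^sub>v x"
  have u: "u \<in> carrier_vec m" "vec_norm2 u = 1"
    using x S by (simp_all add: u_def vec_norm2_smult norm_divide)
  have Awu: "A *\<^sub>v w = complex_of_real S \<cdot>\<^sub>v u"
    using S by (simp add: Aw u_def smult_smult_assoc)
  \<comment> \<open>The phase put into \<open>u\<close> meets \<open>cnj h\<close> from
    \<open>Ax\<close>, leaving the real factor \<open>S\<close>.\<close>
  have "h * cnj h = complex_of_real S * complex_of_real S"
    using complex_norm_square[of h] S by (simp add: power2_eq_square)
  then have Au: "mat_adjoint A *\<^sub>v u = complex_of_real S \<cdot>\<^sub>v w"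
    using S x adj by (simp add: u_def mult_mat_vec[OF adj x(1)] Ax smult_smult_assoc)
  have "(A * mat_adjoint A) *\<^sub>v u = complex_of_real (S\<^sup>2) \<cdot>\<^sub>v u"
    unfolding assoc_mult_mat_vec[OF A adj u(1)]
    by (simp add: Au Awu mult_mat_vec[OF A w(1)] smult_smult_assoc power2_eq_square)
  moreover have "(mat_adjoint A * A) *\<^sub>v w = complex_of_real (S\<^sup>2) \<cdot>\<^sub>v w"
    unfolding assoc_mult_mat_vec[OF adj A w(1)]
    by (simp add: Au Awu mult_mat_vec[OF adj u(1)] smult_smult_assoc power2_eq_square)
  moreover have "u = complex_of_real (1 / S) \<cdot>\<^sub>v (A *\<^sub>v w)"
    "w = complex_of_real (1 / S) \<cdot>\<^sub>v (mat_adjoint A *\<^sub>v u)"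
    using S by (simp_all add: Awu Au smult_smult_assoc)
  moreover have "dim_row A = m" "dim_col A = n" using A by auto
  ultimately show ?thesis
    using u w unfolding singular_vector_pair_def u_def[symmetric] by blast
qed

section \<open>The vectors \<open>zvec\<close> and maximisation of the Hankel coefficient\<close>

text \<open>The term for \<open>l = 0\<close> is 1, even at \<open>z = 0\<close>.\<close>

lemma zvec_sum_pos: "n > 0 \<Longrightarrow> (\<Sum>l<n. cmod z ^ (2 * l)) > 0"
  by (rule sum_pos2[of _ 0]) auto

lemma zvec_carrier [simp]: "zvec n z \<in> carrier_vec n"
  by (simp add: zvec_def)

lemma vec_norm2_zvec:
  assumes "n > 0"
  shows "vec_norm2 (zvec n z) = 1"
proof -
  have "(\<Sum>i<n. (cmod (zvec n z $ i))\<^sup>2) =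
      (\<Sum>i<n. cmod z ^ (2 * i) / (\<Sum>l<n. cmod z ^ (2 * l)))"
    using zvec_sum_pos[OF assms, of z]
    by (intro sum.cong)
      (simp_all add: zvec_def norm_mult norm_divide norm_power power_mult_distrib power_divide
        power_mult power_commutes power2_eq_square flip: power_mult_distrib)
  also have "\<dots> = 1" using zvec_sum_pos[OF assms, of z] by (simp flip: sum_divide_distrib)
  finally show ?thesis by (simp add: vec_norm2_def zvec_def)
qed

lemma hankel_coeff_sum:
  assumes A: "A \<in> carrier_mat m n"
  shows "hankel_coeff A z =
    (\<Sum>i<m. \<Sum>j<n. A $$ (i, j) * cnj (zvec n z $ j) * cnj (zvec m z $ i))"
proof -
  have c: "conjugate (zvec n z) \<in> carrier_vec n" by simp
  have dim: "dim_vec (zvec k z) = k" for k by (simp add: zvec_def)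
  then have "conjugate (zvec n z) $ j = cnj (zvec n z $ j)" if "j < n" for j
    using that by (simp add: dim)
  then show ?thesis
    using A dim unfolding hankel_coeff_def
    by (simp add: cscalar_prod_sum[of _ m] mult_mat_vec_sum[OF A c] sum_distrib_right
        del: index_mult_mat_vec vec_index_conjugate)
qed

lemma continuous_on_hankel_coeff:
  assumes A: "A \<in> carrier_mat m n" and "m > 0" "n > 0"
  shows "continuous_on X (\<lambda>z. cmod (hankel_coeff A z))"
proof -
  have zv: "continuous_on X (\<lambda>z. zvec k z $ i)" if "i < k" for i k
  proof -
    have "sqrt (\<Sum>l<k. cmod z ^ (2 * l)) \<noteq> 0" for z using zvec_sum_pos[of k z] that by simp
    then show ?thesis using that by (simp add: zvec_def) (intro continuous_intros ballI; simp)
  qed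
  show ?thesis unfolding hankel_coeff_sum[OF A]
    by (intro continuous_intros zv) auto
qed

text \<open>Reversing the powers extracts \<open>z ^ (n - 1)\<close>, reversing the normalising sum
  extracts its modulus; the quotient is a phase.\<close>

lemma zvec_reverse:
  assumes z: "z \<noteq> 0" and k: "k < n"
  shows "zvec n z $ (n - Suc k) = (z / complex_of_real (cmod z)) ^ (n - 1) * zvec n (1 / z) $ k"
proof -
  define r where "r = cmod z"
  have r: "r > 0" using z by (simp add: r_def)
  \<comment> \<open>Polymorphic in the field: used for the real \<open>r\<close> in the
    normalisation and for the complex \<open>z\<close> in the entries.\<close>
  have rev: "a ^ (n - Suc l) = a ^ (n - 1) * (1 / a) ^ l" if "l < n" "a \<noteq> 0" for l and a :: "'a :: field"
  proof -
    have "n - 1 = n - Suc l + l" using that by simp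
    then have "a ^ (n - 1) = a ^ (n - Suc l) * a ^ l" by (simp only: power_add)
    then show ?thesis using that by (simp add: power_one_over)
  qed
  have "(\<Sum>l<n. r ^ (2 * l)) = (\<Sum>l<n. r ^ (2 * (n - Suc l)))"
    by (rule sum.nat_diff_reindex[symmetric])
  also have "\<dots> = (\<Sum>l<n. (r ^ (n - 1))\<^sup>2 * (1 / r) ^ (2 * l))"
  proof (intro sum.cong refl)
    fix l assume "l \<in> {..<n}"
    then have "r ^ (n - Suc l) = r ^ (n - 1) * (1 / r) ^ l" using r by (intro rev) auto
    then show "r ^ (2 * (n - Suc l)) = (r ^ (n - 1))\<^sup>2 * (1 / r) ^ (2 * l)"
      by (simp only: power_even_eq power_mult_distrib)
  qed
  finally have "sqrt (\<Sum>l<n. r ^ (2 * l)) = r ^ (n - 1) * sqrt (\<Sum>l<n. (1 / r) ^ (2 * l))"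
    using r by (simp add: real_sqrt_mult flip: sum_distrib_left)
  then show ?thesis
    using k z by (simp add: zvec_def rev[OF k z] norm_divide power_divide flip: r_def)
qed

text \<open>Reversing rows and columns exchanges \<open>z\<close> and \<open>1 / z\<close>, which reduces the maximisation over the
  plane to two closed unit discs; the point at infinity is the corner entry \<open>a\<^bsub>M-1,N-1\<^esub>\<close>.\<close>

definition reverse_mat :: "'a mat \<Rightarrow> 'a mat" where
  "reverse_mat A = mat (dim_row A) (dim_col A)
     (\<lambda>(i, j). A $$ (dim_row A - Suc i, dim_col A - Suc j))"

lemma reverse_mat_carrier: "A \<in> carrier_mat m n \<Longrightarrow> reverse_mat A \<in> carrier_mat m n"
  by (auto simp: reverse_mat_def)

lemma hankel_coeff_reverse_mat:
  assumes A: "A \<in> carrier_mat m n" and z: "z \<noteq> 0"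
  shows "cmod (hankel_coeff A z) = cmod (hankel_coeff (reverse_mat A) (1 / z))"
proof -
  \<comment> \<open>The conjugate appears because \<open>hankel_coeff\<close> conjugates both
    vectors.\<close>
  define p where "p = cnj (z / complex_of_real (cmod z))"
  have p: "cmod p = 1" using z by (simp add: p_def norm_divide)
  have "hankel_coeff A z = (\<Sum>i<m. \<Sum>j<n. A $$ (m - Suc i, n - Suc j) *
      cnj (zvec n z $ (n - Suc j)) * cnj (zvec m z $ (m - Suc i)))"
    unfolding hankel_coeff_sum[OF A]
    by (subst sum.nat_diff_reindex[symmetric], subst (2) sum.nat_diff_reindex[symmetric]) simp
  also have "\<dots> = (\<Sum>i<m. \<Sum>j<n. p ^ (n - 1) * p ^ (m - 1) * (reverse_mat A $$ (i, j) *
      cnj (zvec n (1 / z) $ j) * cnj (zvec m (1 / z) $ i)))"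
    using A by (intro sum.cong refl) (simp add: zvec_reverse[OF z] reverse_mat_def p_def)
  also have "\<dots> = p ^ (n - 1) * p ^ (m - 1) * hankel_coeff (reverse_mat A) (1 / z)"
    by (simp only: hankel_coeff_sum[OF reverse_mat_carrier[OF A]] sum_distrib_left)
  finally show ?thesis using p by (simp add: norm_mult norm_power)
qed

text \<open>As \<open>0 ^ 0 = 1\<close>, \<open>zvec k 0\<close> is the first unit vector. Applied
  to \<open>reverse_mat A\<close>, this yields the opposite corner of \<open>A\<close>.\<close>

lemma hankel_coeff_0:
  assumes A: "A \<in> carrier_mat m n" and "m > 0" "n > 0"
  shows "hankel_coeff A 0 = A $$ (0, 0)"
proof -
  have z: "zvec k 0 $ i = (if i = 0 then 1 else 0)" if "i < k" for k i
  proof -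
    have "(\<Sum>l<k. (0::real) ^ (2 * l)) = (\<Sum>l<k. if l = 0 then 1 else 0)"
      by (intro sum.cong) (auto simp: power_0_left)
    then show ?thesis using that by (simp add: zvec_def)
  qed
  have "hankel_coeff A 0 = (\<Sum>i<m. \<Sum>j<n. if j = 0 then if i = 0 then A $$ (0, 0) else 0 else 0)"
    unfolding hankel_coeff_sum[OF A] by (intro sum.cong refl) (auto simp: z)
  then show ?thesis using assms by simp
qed

lemma hankel_coeff_arg_max_exists:
  assumes A: "A \<in> carrier_mat m n" and m: "m > 0" and n: "n > 0"
    and corner: "cmod (A $$ (0, 0)) \<ge> cmod (A $$ (m - 1, n - 1))"
  shows "\<exists>z. is_arg_max (\<lambda>z. cmod (hankel_coeff A z)) (\<lambda>_. True) z"
proof -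
  let ?f = "\<lambda>z. cmod (hankel_coeff A z)" and ?g = "\<lambda>z. cmod (hankel_coeff (reverse_mat A) z)"
  note A' = reverse_mat_carrier[OF A]
  have cpt: "compact (cball (0::complex) 1)" "cball (0::complex) 1 \<noteq> {}" by auto
  obtain z1 where z1: "\<And>z. cmod z \<le> 1 \<Longrightarrow> ?f z \<le> ?f z1"
    using continuous_attains_sup[OF cpt continuous_on_hankel_coeff[OF A m n]] by (metis mem_cball_0)
  obtain w1 where w1: "\<And>z. cmod z \<le> 1 \<Longrightarrow> ?g z \<le> ?g w1"
    using continuous_attains_sup[OF cpt continuous_on_hankel_coeff[OF A' m n]] by (metis mem_cball_0)
  have inside_or_outside: "?f z \<le> max (?f z1) (?g w1)" for z
  proof (cases "cmod z \<le> 1")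
    case True
    then show ?thesis using z1[of z] by simp
  next
    case False
    then have "1 < cmod z" by simp
    then have "z \<noteq> 0" "cmod (1 / z) \<le> 1" by (auto simp add: norm_divide divide_le_eq_1)
    then show ?thesis using w1[of "1 / z"] hankel_coeff_reverse_mat[OF A, of z] by simp
  qed
  have "\<exists>z2. ?g w1 \<le> ?f z2"
  \<comment> \<open>A maximiser \<open>w1 = 0\<close> of the reversed problem stands for the point
    at infinity; the corner hypothesis lets \<open>z = 0\<close> replace it. Any other
    \<open>w1\<close> corresponds to \<open>1 / w1\<close>.\<close>
  proof (cases "w1 = 0")
    case True
    have "?g 0 = cmod (A $$ (m - 1, n - 1))"
      using hankel_coeff_0[OF A' m n] A m n by (simp add: reverse_mat_def)
    then have "?g w1 \<le> ?f 0" using True corner hankel_coeff_0[OF A m n] by simp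
    then show ?thesis ..
  next
    case False
    then show ?thesis using hankel_coeff_reverse_mat[OF A, of "1 / w1"]
      by (auto intro: exI[of _ "1 / w1"])
  qed
  then obtain z2 where z2: "?g w1 \<le> ?f z2" ..
  then have "?f z \<le> ?f (if ?f z1 \<le> ?f z2 then z2 else z1)" for z
    using inside_or_outside[of z] by (auto simp: max_def split: if_splits)
  then show ?thesis by (metis is_arg_max_linorder)
qed

text \<open>Singular vectors carry a free common phase and \<open>A\<close> ties their relative
  phase, so agreement with the \<open>zvec\<close> vectors is read up to unimodular
  \<open>\<alpha>\<close> and \<open>\<beta>\<close>. The first conjunct keeps the quantification
  over maximisers from being vacuous.\<close>

theorem theorem3p3:
  fixes A :: "complex mat" and M N :: nat
  assumes "M \<ge> 2" and "N \<ge> 2"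
    and "A \<in> carrier_mat M N"
    and "A \<noteq> 0\<^sub>m M N"
    and "cmod (A $$ (0, 0)) \<ge> cmod (A $$ (M - 1, N - 1))"
  shows "(\<exists>zt. is_arg_max (\<lambda>z. cmod (hankel_coeff A z)) (\<lambda>_. True) zt) \<and>
    (\<forall>zt ct. is_arg_max (\<lambda>z. cmod (hankel_coeff A z)) (\<lambda>_. True) zt \<longrightarrow>
       ct = hankel_coeff A zt \<longrightarrow>
       ((is_arg_min (\<lambda>(c, z). (frobenius_norm (A - hankel_rank1 M N c z))\<^sup>2)
           (\<lambda>_. True) (ct, zt) \<and>
         (frobenius_norm (A - hankel_rank1 M N ct zt))\<^sup>2 =
           (frobenius_norm A)\<^sup>2 - (largest_singular_value A)\<^sup>2 \<and>
         (frobenius_norm A)\<^sup>2 - (largest_singular_value A)\<^sup>2 =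
           (frobenius_norm A)\<^sup>2 - (spectral_norm A)\<^sup>2)
        \<longleftrightarrow>
        (\<exists>u0 v0. singular_vector_pair A (largest_singular_value A) u0 v0 \<and>
           (\<exists>\<alpha> \<beta>. cmod \<alpha> = 1 \<and> cmod \<beta> = 1 \<and>
              u0 = \<alpha> \<cdot>\<^sub>v zvec M zt \<and> v0 = \<beta> \<cdot>\<^sub>v conjugate (zvec N zt)))))"
proof (intro conjI allI impI)
  note A = \<open>A \<in> carrier_mat M N\<close>
  have M: "M > 0" and N: "N > 0" using assms by auto
  show "\<exists>zt. is_arg_max (\<lambda>z. cmod (hankel_coeff A z)) (\<lambda>_. True) zt"
    by (rule hankel_coeff_arg_max_exists[OF A M N]) fact
  fix zt ct
  assume "is_arg_max (\<lambda>z. cmod (hankel_coeff A z)) (\<lambda>_. True) zt"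
  then have max: "cmod (hankel_coeff A z) \<le> cmod (hankel_coeff A zt)" for z
    by (simp add: is_arg_max_linorder)
  assume ct: "ct = hankel_coeff A zt"
  define S where "S = spectral_norm A"
  have S: "S > 0" unfolding S_def by (rule spectral_norm_pos[OF A]) fact
  have lsv: "largest_singular_value A = S" unfolding S_def by (rule largest_singular_value_eq[OF A N])
  have err: "(frobenius_norm (A - hankel_rank1 M N c z))\<^sup>2 =
      (frobenius_norm A)\<^sup>2 - (cmod (hankel_coeff A z))\<^sup>2 + (cmod (c - hankel_coeff A z))\<^sup>2" for c z
    using frobenius_norm_diff_outer_prod[OF A zvec_carrier vec_norm2_zvec[OF M] zvec_carrier
        vec_norm2_zvec[OF N]] A
    by (simp add: hankel_rank1_def hankel_coeff_def)
  let ?x = "zvec M zt" and ?w = "conjugate (zvec N zt)"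
  have h: "ct = (A *\<^sub>v ?w) \<bullet>c ?x" using A by (simp add: ct hankel_coeff_def)
  have x: "?x \<in> carrier_vec M" "vec_norm2 ?x = 1" by (simp_all add: vec_norm2_zvec[OF M])
  have "vec_norm2 ?w = vec_norm2 (zvec N zt)" by (simp add: vec_norm2_def conjugate_complex_def)
  then have w: "?w \<in> carrier_vec N" "vec_norm2 ?w = 1" by (simp_all add: vec_norm2_zvec[OF N])
  \<comment> \<open>Minimality holds for every maximiser \<open>zt\<close>, so the left side of the
    equivalence reduces to \<open>cmod ct = S\<close>.\<close>
  have "is_arg_min (\<lambda>(c, z). (frobenius_norm (A - hankel_rank1 M N c z))\<^sup>2) (\<lambda>_. True) (ct, zt)"
  proof -
    have "- (cmod (hankel_coeff A zt))\<^sup>2 \<le>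
        (cmod (c - hankel_coeff A z))\<^sup>2 - (cmod (hankel_coeff A z))\<^sup>2" for c z
      using power_mono[OF max[of z] norm_ge_zero, of 2] zero_le_power2[of "cmod (c - hankel_coeff A z)"]
      by linarith
    then show ?thesis by (auto simp: is_arg_min_linorder err ct)
  qed
  then have "(is_arg_min (\<lambda>(c, z). (frobenius_norm (A - hankel_rank1 M N c z))\<^sup>2)
           (\<lambda>_. True) (ct, zt) \<and>
         (frobenius_norm (A - hankel_rank1 M N ct zt))\<^sup>2 =
           (frobenius_norm A)\<^sup>2 - (largest_singular_value A)\<^sup>2 \<and>
         (frobenius_norm A)\<^sup>2 - (largest_singular_value A)\<^sup>2 =
           (frobenius_norm A)\<^sup>2 - (spectral_norm A)\<^sup>2) \<longleftrightarrow> cmod ct = S"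
    using S by (simp add: err lsv flip: S_def ct)
  also have "\<dots> \<longleftrightarrow>
        (\<exists>u0 v0. singular_vector_pair A (largest_singular_value A) u0 v0 \<and>
           (\<exists>\<alpha> \<beta>. cmod \<alpha> = 1 \<and> cmod \<beta> = 1 \<and>
              u0 = \<alpha> \<cdot>\<^sub>v zvec M zt \<and> v0 = \<beta> \<cdot>\<^sub>v conjugate (zvec N zt)))"
  proof
    assume abs: "cmod ct = S"
    have "singular_vector_pair A S ((ct / complex_of_real S) \<cdot>\<^sub>v ?x) ?w"
      by (rule singular_vector_pair_of_maximal[OF A N x w h abs S_def S])
    moreover have "cmod (ct / complex_of_real S) = 1" using abs S by (simp add: norm_divide)
    moreover have "?w = 1 \<cdot>\<^sub>v ?w" by simp
    ultimately show "\<exists>u0 v0. singular_vector_pair A (largest_singular_value A) u0 v0 \<and>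
           (\<exists>\<alpha> \<beta>. cmod \<alpha> = 1 \<and> cmod \<beta> = 1 \<and> u0 = \<alpha> \<cdot>\<^sub>v ?x \<and> v0 = \<beta> \<cdot>\<^sub>v ?w)"
      unfolding lsv by (metis norm_one)
  next
    assume "\<exists>u0 v0. singular_vector_pair A (largest_singular_value A) u0 v0 \<and>
           (\<exists>\<alpha> \<beta>. cmod \<alpha> = 1 \<and> cmod \<beta> = 1 \<and> u0 = \<alpha> \<cdot>\<^sub>v ?x \<and> v0 = \<beta> \<cdot>\<^sub>v ?w)"
    then obtain \<alpha> \<beta> where ab: "cmod \<alpha> = 1" "cmod \<beta> = 1"
      and pair: "singular_vector_pair A S (\<alpha> \<cdot>\<^sub>v ?x) (\<beta> \<cdot>\<^sub>v ?w)" by (auto simp: lsv)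
    have Aw: "A *\<^sub>v ?w \<in> carrier_vec M" using A w by auto
    \<comment> \<open>Pairing the relation between the two singular vectors with \<open>?x\<close>
      isolates \<open>ct\<close>; the phases vanish on taking moduli.\<close>
    have "\<alpha> \<cdot>\<^sub>v ?x = complex_of_real (1 / S) \<cdot>\<^sub>v (\<beta> \<cdot>\<^sub>v (A *\<^sub>v ?w))"
      using pair by (simp only: singular_vector_pair_def mult_mat_vec[OF A w(1)])
    then have "(\<alpha> \<cdot>\<^sub>v ?x) \<bullet>c ?x = (complex_of_real (1 / S) \<cdot>\<^sub>v (\<beta> \<cdot>\<^sub>v (A *\<^sub>v ?w))) \<bullet>c ?x" by simp
    then have "\<alpha> = complex_of_real (1 / S) * (\<beta> * ct)"
      using x Aw cscalar_prod_self[of ?x] by (simp add: h smult_scalar_prod_distrib[of _ M])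
    then have "1 = cmod (complex_of_real (1 / S) * (\<beta> * ct))" using ab by simp
    also have "\<dots> = cmod ct / S" using ab S by (simp add: norm_mult norm_divide)
    finally show "cmod ct = S" using S by simp
  qed
  finally show "(is_arg_min (\<lambda>(c, z). (frobenius_norm (A - hankel_rank1 M N c z))\<^sup>2)
           (\<lambda>_. True) (ct, zt) \<and>
         (frobenius_norm (A - hankel_rank1 M N ct zt))\<^sup>2 =
           (frobenius_norm A)\<^sup>2 - (largest_singular_value A)\<^sup>2 \<and>
         (frobenius_norm A)\<^sup>2 - (largest_singular_value A)\<^sup>2 =
           (frobenius_norm A)\<^sup>2 - (spectral_norm A)\<^sup>2) \<longleftrightarrow>
        (\<exists>u0 v0. singular_vector_pair A (largest_singular_value A) u0 v0 \<and>
           (\<exists>\<alpha> \<beta>. cmod \<alpha> = 1 \<and> cmod \<beta> = 1 \<and>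
              u0 = \<alpha> \<cdot>\<^sub>v zvec M zt \<and> v0 = \<beta> \<cdot>\<^sub>v conjugate (zvec N zt)))" .
qed

end
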